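(* Let $\beta\in(\frac12,1)$, $p\in(0,1)$ and $q=1-p$. Let $(Y_k)_{k\in\mathbb{N}_0}$ be an i.i.d. sequence of random variables with common distribution function $F_{\beta,p}$, and let $M_n^{\circ}=\max\{Y_0,\ldots,Y_{n-1}\}$. For $n\in\mathbb{N}$ let $a_n=\beta^{-n}$, $b_n=1$ and $k(n)=\lfloor q^{-n}\rfloor$. Then for all $x<0$, as $n\to\infty$, $$\mathbb{P}\left(a_n(M_{k(n)}^{\circ}-b_n)\le x\right)\to\exp\left(-(-x)^{\log q/\log\beta}\,\nu_{\beta,q}^{\to}(\log(-x))\right).$$ In particular, $F_{\beta,p}$ belongs to the domain of geometric partial attraction of a max-semistable distribution with parameters $\alpha=\log q/\log\beta>0$ and $c=q^{-1}>1$.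
   Context: For $\beta,p\in(0,1)$, let $(\varepsilon_j)_{j\in\mathbb{Z}}$ be i.i.d. with $\mathbb{P}(\varepsilon_j=0)=p$ and $\mathbb{P}(\varepsilon_j=1-\beta)=1-p$. $F_{\beta,p}$ denotes the distribution function of $\sum_{j=0}^\infty\beta^j\varepsilon_{-j}$ (the stationary distribution function of the AR(1) process $X_{k+1}=\beta X_k+\varepsilon_{k+1}$). $F_{\beta,q}$ denotes the same object with $p$ replaced by $q=1-p$. For $\beta\in(\frac12,1)$ there is a continuous $\log(1/\beta)$-periodic function $\nu_{\beta,q}:(-\infty,\log(\frac1\beta-1)]\to(0,\infty)$ such that $F_{\beta,q}(y)=y^{\log q/\log\beta}\,\nu_{\beta,q}(\log y)$ for all $y\in(0,\frac1\beta-1]$. The function $\nu_{\beta,q}^{\to}:\mathbb{R}\to(0,\infty)$ is the extension of $\nu_{\beta,q}$ to a $\log(1/\beta)$-periodic function on $\mathbb{R}$. A distribution function $F$ belongs to the domain of geometric partial attraction of a non-degenerate distribution function $H$ (then called max-semistable) if there are a subsequence $(k(n))_{n\in\mathbb{N}}$ of positive integers with $k(n+1)/k(n)\to c\ge1$ and normalizations $a_n>0$, $b_n\in\mathbb{R}$ such that $\left(F(a_n^{-1}x+b_n)\right)^{k(n)}\to H(x)$ as $n\to\infty$ at all continuity points $x$ of $H$. Here the relevant max-semistable distribution functions with parameters $\alpha>0$ and $c>1$ are those of Weibull type: $H(x)=\exp\left(-(-x)^{\alpha}\nu(\log(-x))\right)$ for $x<0$ and $H(x)=1$ for $x\ge0$,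 where $\nu$ is a positive, bounded and $\log(c^{1/\alpha})$-periodic function. *)

theory Defs
  imports "HOL-Probability.Probability"
begin

text \<open>
  The i.i.d. innovations are realised canonically: on the product of the two-point laws
  \<open>bernoulli_pmf p\<close> over the index set of all integers, the coordinate \<open>\<omega> j\<close> records
  whether the \<open>j\<close>-th innovation vanishes. Hence \<open>ar1_innov \<beta> j\<close> is \<open>0\<close> with
  probability \<open>p\<close> and \<open>1 - \<beta>\<close> with probability \<open>1 - p\<close>.
\<close>

definition ar1_space :: "real \<Rightarrow> (int \<Rightarrow> bool) measure" where
  "ar1_space p = Pi\<^sub>M (UNIV :: int set) (\<lambda>_. measure_pmf (bernoulli_pmf p))"

definition ar1_innov :: "real \<Rightarrow> int \<Rightarrow> (int \<Rightarrow> bool) \<Rightarrow> real" where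
  "ar1_innov \<beta> j \<omega> = (if \<omega> j then 0 else 1 - \<beta>)"

definition ar1_stationary :: "real \<Rightarrow> (int \<Rightarrow> bool) \<Rightarrow> real" where
  "ar1_stationary \<beta> \<omega> = (\<Sum>j. \<beta> ^ j * ar1_innov \<beta> (- int j) \<omega>)"

definition ar1_cdf :: "real \<Rightarrow> real \<Rightarrow> real \<Rightarrow> real" where
  "ar1_cdf \<beta> p = cdf (distr (ar1_space p) borel (ar1_stationary \<beta>))"

lemma summable_ar1:
  assumes "0 < \<beta>" "\<beta> < 1"
  shows "summable (\<lambda>j. \<beta> ^ j * ar1_innov \<beta> (- int j) \<omega>)"
proof (rule summable_comparison_test')
  show "summable (\<lambda>j. \<beta> ^ j)"
    using assms by (simp add: summable_geometric)
  show "norm (\<beta> ^ j * ar1_innov \<beta> (- int j) \<omega>) \<le> \<beta> ^ j" if "j \<ge> 0" for j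
    using assms by (auto simp: ar1_innov_def abs_mult intro!: mult_left_le)
qed

lemma measurable_ar1_stationary [measurable]:
  "ar1_stationary \<beta> \<in> borel_measurable (ar1_space p)"
  unfolding ar1_stationary_def ar1_innov_def ar1_space_def by measurable

lemma prob_space_ar1_space: "prob_space (ar1_space p)"
  unfolding ar1_space_def by (intro prob_space_PiM prob_space_measure_pmf)

lemma real_distribution_ar1:
  "real_distribution (distr (ar1_space p) borel (ar1_stationary \<beta>))"
  using prob_space.real_distribution_distr[OF prob_space_ar1_space measurable_ar1_stationary] .

text \<open>
  \<open>is_nu\<close> expresses the defining properties of the function \<open>\<nu>\<^sub>\<beta>\<^sub>,\<^sub>q\<close>, which lives on
  the half-line \<open>{..ln (1/\<beta> - 1)}\<close> only; values of \<open>\<nu>\<close> outside it are irrelevant.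
\<close>

definition is_nu :: "real \<Rightarrow> real \<Rightarrow> (real \<Rightarrow> real) \<Rightarrow> bool" where
  "is_nu \<beta> q \<nu> \<longleftrightarrow>
     continuous_on {..ln (1/\<beta> - 1)} \<nu> \<and>
     (\<forall>t \<le> ln (1/\<beta> - 1). 0 < \<nu> t) \<and>
     (\<forall>t \<le> ln (1/\<beta> - 1). \<nu> (t - ln (1/\<beta>)) = \<nu> t) \<and>
     (\<forall>y \<in> {0<..1/\<beta> - 1}. ar1_cdf \<beta> q y = y powr (ln q / ln \<beta>) * \<nu> (ln y))"

definition is_nu_ext :: "real \<Rightarrow> real \<Rightarrow> (real \<Rightarrow> real) \<Rightarrow> bool" where
  "is_nu_ext \<beta> q \<nu> \<longleftrightarrow>
     is_nu \<beta> q \<nu> \<and> (\<forall>t. 0 < \<nu> t) \<and> (\<forall>t. \<nu> (t + ln (1/\<beta>)) = \<nu> t)"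

definition nu_ext :: "real \<Rightarrow> real \<Rightarrow> real \<Rightarrow> real" where
  "nu_ext \<beta> q = (THE \<nu>. is_nu_ext \<beta> q \<nu>)"

lemma is_nu_ext_unique:
  assumes \<beta>: "0 < \<beta>" "\<beta> < 1" and f: "is_nu_ext \<beta> q f" and g: "is_nu_ext \<beta> q g"
  shows "f = g"
proof
  fix t
  define d where "d = ln (1/\<beta>)"
  have d: "d > 0" using \<beta> by (simp add: d_def)
  have shift: "h (t - real n * d) = h t" if h: "is_nu_ext \<beta> q h" for h n
  proof (induction n)
    case (Suc n)
    have "h ((t - real (Suc n) * d) + d) = h (t - real (Suc n) * d)"
      using h unfolding is_nu_ext_def d_def by blast
    then show ?case using Suc by (simp add: algebra_simps)
  qed simp
  obtain n :: nat where n: "(t - ln (1/\<beta> - 1)) / d \<le> real n"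
    using real_arch_simple by blast
  define s where "s = t - real n * d"
  have "s \<le> ln (1/\<beta> - 1)" using n d by (simp add: s_def field_simps)
  moreover have pos: "1/\<beta> - 1 > 0" using \<beta> by simp
  ultimately have y: "exp s \<in> {0<..1/\<beta> - 1}" by (simp add: ln_ge_iff)
  have "exp s powr (ln q / ln \<beta>) * f s = exp s powr (ln q / ln \<beta>) * g s"
    using f g y unfolding is_nu_ext_def is_nu_def by (metis ln_exp)
  then have "f s = g s" by simp
  then show "f t = g t" using shift[OF f] shift[OF g] by (simp add: s_def)
qed

corollary nu_ext_eqI:
  "0 < \<beta> \<Longrightarrow> \<beta> < 1 \<Longrightarrow> is_nu_ext \<beta> q \<nu> \<Longrightarrow> nu_ext \<beta> q = \<nu>"
  unfolding nu_ext_def by (blast intro: the_equality is_nu_ext_unique)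

definition distribution_function :: "(real \<Rightarrow> real) \<Rightarrow> bool" where
  "distribution_function F \<longleftrightarrow> (\<exists>N. real_distribution N \<and> F = cdf N)"

definition nondegenerate :: "(real \<Rightarrow> real) \<Rightarrow> bool" where
  "nondegenerate H \<longleftrightarrow> \<not> (\<exists>a. \<forall>x. H x = (if x < a then 0 else 1))"

text \<open>
  The constant \<open>c\<close> is the limit of the ratios of consecutive terms of the subsequence;
  \<open>F\<close> lies in the domain of geometric partial attraction of \<open>H\<close> if the relation below
  holds for some \<open>c\<close>.
\<close>

definition in_geometric_partial_attraction ::
    "real \<Rightarrow> (real \<Rightarrow> real) \<Rightarrow> (real \<Rightarrow> real) \<Rightarrow> bool" where
  "in_geometric_partial_attraction c F H \<longleftrightarrow>
     distribution_function F \<and> distribution_function H \<and> nondegenerate H \<and> c \<ge> 1 \<and>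
     (\<exists>(k :: nat \<Rightarrow> nat) (a :: nat \<Rightarrow> real) (b :: nat \<Rightarrow> real).
        strict_mono k \<and> (\<forall>n. k n > 0) \<and>
        (\<lambda>n. real (k (Suc n)) / real (k n)) \<longlonglongrightarrow> c \<and>
        (\<forall>n. a n > 0) \<and>
        (\<forall>x. isCont H x \<longrightarrow> (\<lambda>n. F (inverse (a n) * x + b n) ^ k n) \<longlonglongrightarrow> H x))"

definition max_semistable_weibull :: "real \<Rightarrow> real \<Rightarrow> (real \<Rightarrow> real) \<Rightarrow> bool" where
  "max_semistable_weibull \<alpha> c H \<longleftrightarrow>
     \<alpha> > 0 \<and> c > 1 \<and> distribution_function H \<and>
     (\<exists>\<nu> :: real \<Rightarrow> real.
        (\<forall>t. 0 < \<nu> t) \<and> bounded (range \<nu>) \<and>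
        (\<forall>t. \<nu> (t + ln (c powr (1/\<alpha>))) = \<nu> t) \<and>
        (\<forall>x. H x = (if x < 0 then exp (- ((- x) powr \<alpha> * \<nu> (ln (- x)))) else 1)))"

end

theory Submission
  imports Defs
begin

text \<open>
  Splitting off the first innovation shows that the stationary law is self-similar: it is the
  mixture of its images under \<open>s \<mapsto> \<beta> s\<close> and \<open>s \<mapsto> 1 - \<beta> + \<beta> s\<close>. Hence it has no atoms, and
  \<open>F\<^sub>\<beta>\<^sub>,\<^sub>q (\<beta> y) = q F\<^sub>\<beta>\<^sub>,\<^sub>q (y)\<close> for \<open>y \<le> 1/\<beta> - 1\<close>. So the blow-up
  \<open>lim q\<^sup>-\<^sup>n F\<^sub>\<beta>\<^sub>,\<^sub>q (\<beta>\<^sup>n y)\<close> is a limit of an eventually constant sequence, and it equals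
  \<open>y\<^sup>\<alpha> \<nu> (log y)\<close>. Exchanging the two values of every innovation reflects the law:
  \<open>F\<^sub>\<beta>\<^sub>,\<^sub>p (1 - y) = 1 - F\<^sub>\<beta>\<^sub>,\<^sub>q (y)\<close>. Therefore
  \<open>P (M\<^sub>k \<le> 1 + \<beta>\<^sup>n x) = (1 - F\<^sub>\<beta>\<^sub>,\<^sub>q (- \<beta>\<^sup>n x))\<^sup>k\<close>, where the subtracted term is eventually
  \<open>q\<^sup>n\<close> times the blow-up at \<open>- x\<close>, and \<open>k(n) q\<^sup>n \<rightarrow> 1\<close>.
\<close>

section \<open>Self-similarity, atoms and reflection of the stationary law\<close>

text \<open>The stationary sum with the past indexed by the naturals, so that prepending a coin is
  \<open>case_nat\<close>.\<close>

definition coin_sum :: "real \<Rightarrow> (nat \<Rightarrow> bool) \<Rightarrow> real" where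
  "coin_sum \<beta> \<omega> = (\<Sum>j. \<beta> ^ j * (if \<omega> j then 0 else 1 - \<beta>))"

abbreviation coin_space :: "real \<Rightarrow> (nat \<Rightarrow> bool) measure" where
  "coin_space p \<equiv> Pi\<^sub>M UNIV (\<lambda>_. measure_pmf (bernoulli_pmf p))"

abbreviation ar1_law :: "real \<Rightarrow> real \<Rightarrow> real measure" where
  "ar1_law \<beta> p \<equiv> distr (ar1_space p) borel (ar1_stationary \<beta>)"

lemma measurable_coin_sum [measurable]: "coin_sum \<beta> \<in> borel_measurable (coin_space p)"
  unfolding coin_sum_def by measurable

text \<open>Only innovations with nonpositive index enter the sum, and reindexing along the
  injection \<open>n \<mapsto> - int n\<close> maps the two-sided product measure to the one-sided
  one.\<close>

lemma ar1_law_eq_coin_law: "ar1_law \<beta> p = distr (coin_space p) borel (coin_sum \<beta>)"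
proof -
  let ?B = "measure_pmf (bernoulli_pmf p)"
  let ?f = "\<lambda>\<omega> (n::nat). \<omega> (- int n) :: bool"
  have "distr (ar1_space p) (coin_space p) ?f = coin_space p"
    using distr_PiM_reindex[of UNIV "\<lambda>_. ?B" "\<lambda>n. - int n" UNIV]
    by (simp add: ar1_space_def prob_space_measure_pmf inj_on_def restrict_UNIV)
  moreover have "?f \<in> measurable (ar1_space p) (coin_space p)"
    unfolding ar1_space_def by (rule measurable_PiM_single') (auto simp: space_PiM)
  moreover have "ar1_stationary \<beta> = coin_sum \<beta> \<circ> ?f"
    by (simp add: fun_eq_iff ar1_stationary_def coin_sum_def ar1_innov_def)
  ultimately show ?thesis
    using distr_distr[of "coin_sum \<beta>" "coin_space p" borel ?f "ar1_space p"]
    by simp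
qed

lemma summable_coin_sum:
  fixes \<beta> :: real
  assumes "0 < \<beta>" "\<beta> < 1"
  shows "summable (\<lambda>j. \<beta> ^ j * (if \<omega> j then 0 else 1 - \<beta>))"
  using summable_ar1[OF assms, of "\<lambda>i. \<omega> (nat (- i))"] by (simp add: ar1_innov_def)

text \<open>Pathwise form of the autoregressive recursion: the new coin is the head of the series,
  and the tail is a copy shrunk by \<open>\<beta>\<close>.\<close>

lemma coin_sum_case_nat:
  assumes "0 < \<beta>" "\<beta> < 1"
  shows "coin_sum \<beta> (case_nat b \<omega>) = (if b then 0 else 1 - \<beta>) + \<beta> * coin_sum \<beta> \<omega>"
proof -
  have "coin_sum \<beta> (case_nat b \<omega>) =
      (\<Sum>j. \<beta> ^ Suc j * (if \<omega> j then 0 else 1 - \<beta>)) + (if b then 0 else 1 - \<beta>)"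
    unfolding coin_sum_def
    using suminf_split_head[OF summable_coin_sum[OF assms, of "case_nat b \<omega>"]]
    by (simp add: algebra_simps)
  also have "(\<Sum>j. \<beta> ^ Suc j * (if \<omega> j then 0 else 1 - \<beta>)) = \<beta> * coin_sum \<beta> \<omega>"
    unfolding coin_sum_def using suminf_mult[OF summable_coin_sum[OF assms], of \<beta> \<omega>]
    by (simp add: mult.assoc)
  finally show ?thesis by simp
qed

text \<open>Prepending an independent coin preserves the product measure (\<open>PiM_iter\<close>);
  conditioning on that coin gives the two affine images with weights \<open>p\<close> and
  \<open>1 - p\<close>.\<close>

lemma ar1_law_selfsimilar:
  assumes \<beta>: "0 < \<beta>" "\<beta> < 1" and p: "0 \<le> p" "p \<le> 1" and A: "A \<in> sets borel"
  shows "measure (ar1_law \<beta> p) A =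
    p * measure (ar1_law \<beta> p) {s. \<beta> * s \<in> A} + (1 - p) * measure (ar1_law \<beta> p) {s. 1 - \<beta> + \<beta> * s \<in> A}"
proof -
  let ?B = "measure_pmf (bernoulli_pmf p)"
  define S where "S = coin_space p"
  define L where "L = ar1_law \<beta> p"
  interpret product_prob_space "\<lambda>_. ?B" "UNIV :: nat set"
    by unfold_locales
  interpret sequence_space ?B
    by unfold_locales
  interpret L: prob_space L
    unfolding L_def using prob_space_ar1_space by (rule prob_space.prob_space_distr) simp
  interpret S: prob_space S
    unfolding S_def by unfold_locales
  have L_eq: "L = distr S borel (coin_sum \<beta>)"
    unfolding L_def S_def by (rule ar1_law_eq_coin_law)
  have c[measurable]: "coin_sum \<beta> \<in> borel_measurable S"
    unfolding S_def by simp
  have case_m: "(\<lambda>(b, \<omega>). case_nat b \<omega>) \<in> measurable (?B \<Otimes>\<^sub>M S) S"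
    unfolding S_def by measurable
  have iter: "distr (?B \<Otimes>\<^sub>M S) S (\<lambda>(b, \<omega>). case_nat b \<omega>) = S"
    unfolding S_def by (rule PiM_iter)
  have comp: "L = distr (?B \<Otimes>\<^sub>M S) borel (coin_sum \<beta> \<circ> (\<lambda>(b, \<omega>). case_nat b \<omega>))"
    unfolding L_eq using distr_distr[OF c case_m] iter by simp
  have step: "coin_sum \<beta> \<circ> (\<lambda>(b, \<omega>). case_nat b \<omega>) =
      (\<lambda>(b, \<omega>). (if b then 0 else 1 - \<beta>) + \<beta> * coin_sum \<beta> \<omega>)" (is "_ = ?g")
    by (auto simp: fun_eq_iff coin_sum_case_nat[OF \<beta>])
  have g: "?g \<in> borel_measurable (?B \<Otimes>\<^sub>M S)"
    by measurable
  have pre: "emeasure S (Pair b -` (?g -` A \<inter> space (?B \<Otimes>\<^sub>M S))) =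
      emeasure L {s. (if b then 0 else 1 - \<beta>) + \<beta> * s \<in> A}" for b
  proof -
    have "{s. (if b then 0 else 1 - \<beta>) + \<beta> * s \<in> A} \<in> sets borel"
      using measurable_sets[of "\<lambda>s. (if b then 0 else 1 - \<beta>) + \<beta> * s" borel borel A] A
      by (simp add: vimage_def)
    then show ?thesis
      unfolding L_eq by (subst emeasure_distr) (auto simp: space_pair_measure intro!: arg_cong2[where f=emeasure])
  qed
  have "emeasure L A = emeasure (?B \<Otimes>\<^sub>M S) (?g -` A \<inter> space (?B \<Otimes>\<^sub>M S))"
    unfolding comp step using g A by (rule emeasure_distr)
  also have "\<dots> = (\<integral>\<^sup>+b. emeasure L {s. (if b then 0 else 1 - \<beta>) + \<beta> * s \<in> A} \<partial>?B)"
    by (subst S.emeasure_pair_measure_alt[OF measurable_sets[OF g A]]) (simp only: pre)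
  also have "\<dots> = emeasure L {s. \<beta> * s \<in> A} * p + emeasure L {s. 1 - \<beta> + \<beta> * s \<in> A} * (1 - p)"
    using p by simp
  also have "\<dots> = ennreal (p * measure L {s. \<beta> * s \<in> A} + (1 - p) * measure L {s. 1 - \<beta> + \<beta> * s \<in> A})"
    using p by (simp add: L.emeasure_eq_measure ennreal_mult' mult.commute ennreal_plus ennreal_1[symmetric] ennreal_minus
      del: ennreal_1)
  finally show ?thesis
    using p by (simp add: L.emeasure_eq_measure del: ennreal_plus flip: L_def)
qed

section \<open>Reflection under exchange of the two innovation values\<close>

lemma ar1_stationary_Not:
  assumes "0 < \<beta>" "\<beta> < 1"
  shows "ar1_stationary \<beta> (\<lambda>i. \<not> \<omega> i) = 1 - ar1_stationary \<beta> \<omega>"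
proof -
  have "ar1_stationary \<beta> (\<lambda>i. \<not> \<omega> i) + ar1_stationary \<beta> \<omega> =
      (\<Sum>j. \<beta> ^ j * ar1_innov \<beta> (- int j) (\<lambda>i. \<not> \<omega> i) + \<beta> ^ j * ar1_innov \<beta> (- int j) \<omega>)"
    unfolding ar1_stationary_def by (intro suminf_add summable_ar1 assms)
  \<comment> \<open>At each index exactly one of the two innovations is \<open>1 - \<beta>\<close>
    and the other is 0.\<close>
  also have "\<dots> = (\<Sum>j. \<beta> ^ j * (1 - \<beta>))"
    by (intro suminf_cong) (simp add: ar1_innov_def)
  also have "\<dots> = 1"
    using assms suminf_mult2[of "\<lambda>j. \<beta> ^ j" "1 - \<beta>"] suminf_geometric[of \<beta>]
      summable_geometric[of \<beta>] by simp
  finally show ?thesis by simp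
qed

text \<open>A product measure is determined by its cylinder sets, and on each coordinate negation
  maps \<open>bernoulli_pmf p\<close> to \<open>bernoulli_pmf (1 - p)\<close>.\<close>

lemma distr_ar1_space_Not:
  assumes p: "0 \<le> p" "p \<le> 1"
  shows "distr (ar1_space p) (ar1_space (1 - p)) (\<lambda>\<omega> i. \<not> \<omega> i) = ar1_space (1 - p)"
proof -
  interpret q: product_prob_space "\<lambda>_. measure_pmf (bernoulli_pmf (1 - p))" "UNIV :: int set"
    by unfold_locales
  have m: "(\<lambda>\<omega> i. \<not> \<omega> i) \<in> measurable (ar1_space p) (ar1_space (1 - p))"
    unfolding ar1_space_def by (rule measurable_PiM_single') (auto simp: space_PiM)
  show ?thesis
    unfolding ar1_space_def
  proof (rule q.PiM_eq)
    fix J :: "int set" and F :: "int \<Rightarrow> bool set"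
    assume J: "finite J"
    let ?q = "measure_pmf (bernoulli_pmf (1 - p))"
    let ?p = "measure_pmf (bernoulli_pmf p)"
    let ?X = "prod_emb UNIV (\<lambda>_. ?q) J (Pi\<^sub>E J F)"
    have flip: "emeasure ?p (Not -` C) = emeasure ?q C" for C
    proof -
      have "map_pmf Not (bernoulli_pmf p) = bernoulli_pmf (1 - p)"
      proof (rule pmf_eqI)
        fix b
        \<comment> \<open>Writing \<open>b\<close> as \<open>Not (\<not> b)\<close> lets injectivity
          of \<open>Not\<close> compute the mass of the image.\<close>
        have "pmf (map_pmf Not (bernoulli_pmf p)) (Not (\<not> b)) = pmf (bernoulli_pmf p) (\<not> b)"
          by (rule pmf_map_inj') (simp add: inj_def)
        then show "pmf (map_pmf Not (bernoulli_pmf p)) b = pmf (bernoulli_pmf (1 - p)) b"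
          using p by (cases b) simp_all
      qed
      then show ?thesis by (metis emeasure_map_pmf)
    qed
    have pre: "(\<lambda>\<omega> i. \<not> \<omega> i) -` ?X \<inter> space (ar1_space p) = prod_emb UNIV (\<lambda>_. ?p) J (\<Pi>\<^sub>E j\<in>J. Not -` F j)"
      by (auto simp: prod_emb_def ar1_space_def space_PiM PiE_iff)
    have "emeasure (distr (ar1_space p) (ar1_space (1 - p)) (\<lambda>\<omega> i. \<not> \<omega> i)) ?X =
        emeasure (ar1_space p) (prod_emb UNIV (\<lambda>_. ?p) J (\<Pi>\<^sub>E j\<in>J. Not -` F j))"
      unfolding pre[symmetric]
      by (rule emeasure_distr[OF m]) (use J in \<open>auto simp: ar1_space_def intro!: sets_PiM_I\<close>)
    also have "\<dots> = (\<Prod>j\<in>J. emeasure ?q (F j))"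
      unfolding ar1_space_def using J
      by (subst emeasure_PiM_emb) (auto simp: prob_space_measure_pmf flip)
    finally show "emeasure (distr (Pi\<^sub>M UNIV (\<lambda>_. ?p)) (Pi\<^sub>M UNIV (\<lambda>_. ?q)) (\<lambda>\<omega> i. \<not> \<omega> i)) ?X =
        (\<Prod>j\<in>J. emeasure ?q (F j))"
      by (simp add: ar1_space_def)
  qed simp
qed

lemma ar1_law_reflect:
  assumes \<beta>: "0 < \<beta>" "\<beta> < 1" and p: "0 \<le> p" "p \<le> 1"
  shows "ar1_law \<beta> (1 - p) = distr (ar1_law \<beta> p) borel (\<lambda>s. 1 - s)"
proof -
  have m: "(\<lambda>\<omega> i. \<not> \<omega> i) \<in> measurable (ar1_space p) (ar1_space (1 - p))"
    unfolding ar1_space_def by (rule measurable_PiM_single') (auto simp: space_PiM)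
  have "ar1_law \<beta> (1 - p) = distr (ar1_space p) borel (ar1_stationary \<beta> \<circ> (\<lambda>\<omega> i. \<not> \<omega> i))"
    using distr_distr[OF measurable_ar1_stationary m] distr_ar1_space_Not[OF p] by simp
  also have "\<dots> = distr (ar1_space p) borel ((\<lambda>s. 1 - s) \<circ> ar1_stationary \<beta>)"
    by (simp add: comp_def ar1_stationary_Not[OF \<beta>])
  also have "\<dots> = distr (ar1_law \<beta> p) borel (\<lambda>s. 1 - s)"
    by (rule distr_distr[symmetric]) simp_all
  finally show ?thesis .
qed

section \<open>Support and absence of atoms\<close>

lemma ar1_stationary_bounds:
  assumes "0 < \<beta>" "\<beta> < 1"
  shows "0 \<le> ar1_stationary \<beta> \<omega>" "ar1_stationary \<beta> \<omega> \<le> 1"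
proof -
  have nonneg: "0 \<le> ar1_stationary \<beta> \<omega>" for \<omega>
    unfolding ar1_stationary_def
    by (intro suminf_nonneg summable_ar1 assms) (use assms in \<open>simp add: ar1_innov_def\<close>)
  show "0 \<le> ar1_stationary \<beta> \<omega>" by (rule nonneg)
  \<comment> \<open>The upper bound is the lower bound for the flipped coins.\<close>
  show "ar1_stationary \<beta> \<omega> \<le> 1"
    using nonneg[of "\<lambda>i. \<not> \<omega> i"] ar1_stationary_Not[OF assms, of \<omega>] by simp
qed

text \<open>
  By self-similarity the set of points of maximal mass, finite and nonempty if there is an atom,
  is closed under \<open>x \<mapsto> x / \<beta>\<close> and \<open>x \<mapsto> (x - (1 - \<beta>)) / \<beta>\<close>. No finite nonempty set is.
\<close>

lemma ar1_law_no_atoms: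
  assumes \<beta>: "0 < \<beta>" "\<beta> < 1" and p: "0 < p" "p < 1"
  shows "measure (ar1_law \<beta> p) {x} = 0"
proof (rule ccontr)
  assume x: "measure (ar1_law \<beta> p) {x} \<noteq> 0"
  interpret L: real_distribution "ar1_law \<beta> p"
    by (rule real_distribution_ar1)
  define f where "f y = L.prob {y}" for y
  have f: "f y = p * f (y / \<beta>) + (1 - p) * f ((y - (1 - \<beta>)) / \<beta>)" for y
  proof -
    have "{s. \<beta> * s \<in> {y}} = {y / \<beta>}" "{s. 1 - \<beta> + \<beta> * s \<in> {y}} = {(y - (1 - \<beta>)) / \<beta>}"
      using \<beta> by (auto simp: field_simps)
    then show ?thesis
      unfolding f_def using ar1_law_selfsimilar[OF \<beta>, of p "{y}"] p by simp
  qed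
  \<comment> \<open>More than \<open>1 / d\<close> points of mass at least \<open>d\<close> would
    exceed the total mass 1.\<close>
  have fin: "finite {y. d \<le> f y}" if d: "0 < d" for d
  proof (rule ccontr)
    assume inf: "infinite {y. d \<le> f y}"
    obtain n :: nat where n: "1 < real n * d"
      using reals_Archimedean3[OF d] by blast
    obtain T where T: "finite T" "card T = n" "T \<subseteq> {y. d \<le> f y}"
      using infinite_arbitrarily_large[OF inf] by blast
    have "real n * d \<le> (\<Sum>y\<in>T. f y)"
      using sum_mono[of T "\<lambda>_. d" f] T by auto
    also have "\<dots> = L.prob T"
      unfolding f_def using L.finite_measure_eq_sum_singleton[OF T(1)] by simp
    also have "\<dots> \<le> 1" by simp
    finally show False using n by simp
  qed
  \<comment> \<open>The maximum runs over the points at least as heavy as \<open>x\<close>, a finite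
    set; all others are lighter, so \<open>m\<close> bounds every point mass.\<close>
  define m where "m = Max (f ` {y. f x \<le> f y})"
  have fx: "0 < f x"
    using x by (simp add: f_def zero_less_measure_iff)
  have ne: "f ` {y. f x \<le> f y} \<noteq> {}" and fin_img: "finite (f ` {y. f x \<le> f y})"
    using fin[OF fx] by auto
  have le_m: "f y \<le> m" for y
  proof (cases "f x \<le> f y")
    case True
    then show ?thesis unfolding m_def using fin_img by (intro Max_ge) auto
  next
    case False
    moreover have "f x \<le> m" unfolding m_def using fin_img by (intro Max_ge) auto
    ultimately show ?thesis by simp
  qed
  have m_pos: "0 < m" using le_m[of x] fx by simp
  define A where "A = {y. f y = m}"
  have A_fin: "finite A"
    using fin[OF m_pos] by (rule finite_subset[rotated]) (auto simp: A_def)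
  have A_closed: "y / \<beta> \<in> A" "(y - (1 - \<beta>)) / \<beta> \<in> A" if "y \<in> A" for y
  proof -
    \<comment> \<open>A convex combination with positive weights of two values at most
      \<open>m\<close> equals \<open>m\<close> only if both values do.\<close>
    have eq: "p * (m - f (y / \<beta>)) + (1 - p) * (m - f ((y - (1 - \<beta>)) / \<beta>)) = 0"
      using f[of y] that by (simp add: A_def algebra_simps)
    have "p * (m - f (y / \<beta>)) \<ge> 0" "(1 - p) * (m - f ((y - (1 - \<beta>)) / \<beta>)) \<ge> 0"
      using p le_m by simp_all
    with eq have "p * (m - f (y / \<beta>)) = 0" "(1 - p) * (m - f ((y - (1 - \<beta>)) / \<beta>)) = 0"
      by linarith+
    then show "y / \<beta> \<in> A" "(y - (1 - \<beta>)) / \<beta> \<in> A"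
      using p by (auto simp: A_def)
  qed
  have A_0: "y = 0" if y: "y \<in> A" for y
  proof (rule ccontr)
    assume "y \<noteq> 0"
    have "y / \<beta> ^ n \<in> A" for n
    proof (induction n)
      case (Suc n)
      then show ?case using A_closed(1)[of "y / \<beta> ^ n"] by (simp add: mult.commute)
    qed (use y in simp)
    then have "finite (range (\<lambda>n. y / \<beta> ^ n))"
      using A_fin by (meson finite_subset image_subsetI)
    moreover have "inj (\<lambda>n. y / \<beta> ^ n)"
      using \<open>y \<noteq> 0\<close> \<beta> by (intro injI) (simp add: field_simps power_inject_exp')
    ultimately show False
      using finite_imageD by blast
  qed
  have "m \<in> f ` {y. f x \<le> f y}"
    unfolding m_def using fin_img ne by (rule Max_in)
  \<comment> \<open>The only possible element of \<open>A\<close> is 0, but the second map moves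
    0.\<close>
  then obtain y where "y \<in> A" by (auto simp: A_def)
  then have "(y - (1 - \<beta>)) / \<beta> = 0" "y = 0"
    using A_closed(2) A_0 by blast+
  then show False using \<beta> by simp
qed

section \<open>Blow-up at zero\<close>

text \<open>The properties of \<open>ar1_cdf \<beta> q\<close> behind the blow-up; \<open>c\<close>
  stands for \<open>1/\<beta> - 1\<close>, up to which scaling by \<open>\<beta>\<close> is
  exact.\<close>

locale selfsimilar_at_zero =
  fixes G :: "real \<Rightarrow> real" and \<beta> q c :: real
  assumes \<beta>: "0 < \<beta>" "\<beta> < 1" and q: "0 < q" "q < 1" and c: "0 < c"
    and G_cont: "isCont G y"
    and G_mono: "x \<le> y \<Longrightarrow> G x \<le> G y"
    and G_nonpos: "y \<le> 0 \<Longrightarrow> G y = 0"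
    and G_pos: "0 < y \<Longrightarrow> 0 < G y"
    and G_scale: "y \<le> c \<Longrightarrow> G (\<beta> * y) = q * G y"
begin

definition blowup :: "real \<Rightarrow> real" where
  "blowup y = lim (\<lambda>n. G (\<beta> ^ n * y) / q ^ n)"

definition \<alpha> :: real where
  "\<alpha> = ln q / ln \<beta>"

text \<open>What remains of the blow-up after removing the power, in the logarithmic variable. As
  \<open>blowup\<close> covers all positive arguments, this is already the periodic
  extension.\<close>

definition nu :: "real \<Rightarrow> real" where
  "nu t = exp (- \<alpha> * t) * blowup (exp t)"

text \<open>The value 1 for \<open>x \<ge> 0\<close> is built in, because \<open>blowup\<close>
  vanishes at nonpositive arguments.\<close>

definition H :: "real \<Rightarrow> real" where
  "H x = exp (- blowup (- x))"

lemma G_scale_power: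
  assumes "y \<le> c"
  shows "G (\<beta> ^ n * y) = q ^ n * G y"
proof (induction n)
  case (Suc n)
  \<comment> \<open>Scaling a negative \<open>y\<close> moves it to the right, but never past 0,
    which lies below \<open>c\<close>.\<close>
  have "\<beta> ^ n * y \<le> c"
  proof (cases "y \<le> 0")
    case True
    then have "\<beta> ^ n * y \<le> 0" using \<beta> by (simp add: mult_nonneg_nonpos)
    then show ?thesis using c by linarith
  next
    case False
    then have "\<beta> ^ n * y \<le> y" using \<beta> by (simp add: mult_left_le_one_le power_le_one)
    then show ?thesis using assms by linarith
  qed
  then show ?case using G_scale[of "\<beta> ^ n * y"] Suc by (simp add: mult.assoc)
qed simp

text \<open>By \<open>G_scale_power\<close> the sequence is constant from index \<open>n\<close>
  on.\<close>

lemma blowup_eq: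
  assumes "\<beta> ^ n * y \<le> c"
  shows "blowup y = G (\<beta> ^ n * y) / q ^ n"
proof -
  have "G (\<beta> ^ m * y) / q ^ m = G (\<beta> ^ n * y) / q ^ n" if "n \<le> m" for m
  proof -
    have "\<beta> ^ m * y = \<beta> ^ (m - n) * (\<beta> ^ n * y)"
      using that by (simp flip: power_add mult.assoc)
    moreover have "q ^ m = q ^ (m - n) * q ^ n"
      using that by (simp flip: power_add)
    ultimately show ?thesis using G_scale_power[OF assms, of "m - n"] q by (simp only:) simp
  qed
  then have "eventually (\<lambda>m. G (\<beta> ^ n * y) / q ^ n = G (\<beta> ^ m * y) / q ^ m) sequentially"
    by (intro eventually_sequentiallyI[of n]) (rule sym)
  then have "(\<lambda>m. G (\<beta> ^ m * y) / q ^ m) \<longlonglongrightarrow> G (\<beta> ^ n * y) / q ^ n"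
    by (rule Lim_transform_eventually[OF tendsto_const])
  then show ?thesis unfolding blowup_def by (rule limI)
qed

lemma eventually_power_le: "\<forall>\<^sub>F n in sequentially. \<beta> ^ n * y \<le> c"
proof -
  have "(\<lambda>n. \<beta> ^ n * y) \<longlonglongrightarrow> 0 * y"
    using \<beta> by (intro tendsto_intros LIMSEQ_power_zero) simp
  then have "\<forall>\<^sub>F n in sequentially. \<beta> ^ n * y < c"
    using c by (intro order_tendstoD(2)) auto
  then show ?thesis by eventually_elim simp
qed

lemma obtain_power_le: obtains n where "\<beta> ^ n * y \<le> c"
  using eventually_happens'[OF _ eventually_power_le] by auto

text \<open>The term at index \<open>m + n\<close> for \<open>y / \<beta> ^ n\<close> is the term at
  \<open>m\<close> for \<open>y\<close>, divided by \<open>q ^ n\<close>.\<close>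

lemma blowup_scale: "blowup (y / \<beta> ^ n) = blowup y / q ^ n"
proof -
  obtain m where m: "\<beta> ^ m * y \<le> c" by (rule obtain_power_le)
  have "\<beta> ^ (m + n) * (y / \<beta> ^ n) = \<beta> ^ m * y"
    using \<beta> by (simp add: power_add)
  then show ?thesis
    using blowup_eq[of "m + n" "y / \<beta> ^ n"] blowup_eq[OF m] m by (simp add: power_add)
qed

lemma blowup_nonpos: "y \<le> 0 \<Longrightarrow> blowup y = 0"
  using blowup_eq[of 0 y] G_nonpos[of y] c by simp

lemma blowup_pos:
  assumes "0 < y"
  shows "0 < blowup y"
proof -
  obtain n where n: "\<beta> ^ n * y \<le> c" by (rule obtain_power_le)
  show ?thesis using assms \<beta> q by (simp add: blowup_eq[OF n] G_pos)
qed

lemma blowup_mono: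
  assumes "x \<le> y"
  shows "blowup x \<le> blowup y"
proof -
  obtain n where n: "\<beta> ^ n * y \<le> c" by (rule obtain_power_le)
  have le: "\<beta> ^ n * x \<le> \<beta> ^ n * y" using assms \<beta> by simp
  then have "blowup x = G (\<beta> ^ n * x) / q ^ n" using n by (intro blowup_eq) linarith
  then show ?thesis using blowup_eq[OF n] G_mono[OF le] q by (simp add: divide_right_mono)
qed

text \<open>One index with \<open>\<beta> ^ n * (y + 1) \<le> c\<close> serves all
  \<open>z < y + 1\<close>, so near \<open>y\<close> the blow-up is a rescaled
  \<open>G\<close>.\<close>

lemma isCont_blowup: "isCont blowup y"
proof -
  obtain n where n: "\<beta> ^ n * (y + 1) \<le> c" by (rule obtain_power_le)
  have eq: "blowup z = G (\<beta> ^ n * z) / q ^ n" if "z < y + 1" for z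
  proof (rule blowup_eq)
    have "\<beta> ^ n * z \<le> \<beta> ^ n * (y + 1)" using that \<beta> by (intro mult_left_mono) auto
    then show "\<beta> ^ n * z \<le> c" using n by linarith
  qed
  have "isCont (\<lambda>z. G (\<beta> ^ n * z) / q ^ n) y"
    using q by (intro continuous_intros isCont_o2[OF _ G_cont]) auto
  moreover have "\<forall>\<^sub>F z in nhds y. blowup z = G (\<beta> ^ n * z) / q ^ n"
    using eventually_nhds_in_open[of "{..<y + 1}" y] by (auto elim!: eventually_mono simp: eq)
  ultimately show ?thesis by (simp add: isCont_cong)
qed

text \<open>Along \<open>1 / \<beta> ^ n\<close> the values \<open>blowup 1 / q ^ n\<close> grow
  geometrically; monotonicity fills the gaps.\<close>

lemma blowup_at_top: "filterlim blowup at_top at_top"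
  unfolding filterlim_at_top
proof
  fix Z
  have "1 < 1 / q" using q by simp
  then obtain n where "Z / blowup 1 < (1 / q) ^ n" using real_arch_pow by blast
  then have "Z \<le> blowup 1 / q ^ n"
    using blowup_pos[of 1] q by (simp add: field_simps power_divide)
  then have "Z \<le> blowup (1 / \<beta> ^ n)" by (simp add: blowup_scale)
  then show "\<forall>\<^sub>F y in at_top. Z \<le> blowup y"
    using blowup_mono order_trans by (intro eventually_at_top_linorderI[of "1 / \<beta> ^ n"]) blast
qed

section \<open>Exponent and periodic factor\<close>

lemma \<alpha>_pos: "0 < \<alpha>"
  unfolding \<alpha>_def using \<beta> q by (simp add: divide_neg_neg)

lemma nu_pos: "0 < nu t"
  by (simp add: nu_def blowup_pos)

lemma isCont_nu: "isCont nu t"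
  unfolding nu_def by (intro continuous_intros isCont_o2[OF _ isCont_blowup])

text \<open>One period divides \<open>exp t\<close> by \<open>\<beta>\<close>, which multiplies the
  blow-up by \<open>1 / q\<close>; the prefactor contributes \<open>q\<close>, since
  \<open>\<beta> powr \<alpha> = q\<close>.\<close>

lemma nu_periodic: "nu (t + ln (1 / \<beta>)) = nu t"
proof -
  have ln: "ln (1 / \<beta>) = - ln \<beta>" "ln \<beta> \<noteq> 0" using \<beta> by (simp_all add: ln_div)
  have "exp (t - ln \<beta>) = exp t / \<beta> ^ 1" using \<beta> by (simp add: exp_diff)
  then have "blowup (exp (t - ln \<beta>)) = blowup (exp t) / q"
    using blowup_scale[of "exp t" 1] by simp
  moreover have "- \<alpha> * (t - ln \<beta>) = - \<alpha> * t + ln q"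
    using ln by (simp add: \<alpha>_def field_simps)
  then have "exp (- \<alpha> * (t - ln \<beta>)) = exp (- \<alpha> * t) * q"
    using q by (simp only: exp_add) simp
  ultimately show ?thesis using q by (simp add: nu_def ln)
qed

lemma blowup_eq_powr_nu: "0 < y \<Longrightarrow> blowup y = y powr \<alpha> * nu (ln y)"
  by (simp add: nu_def powr_def exp_minus)

text \<open>Subtracting \<open>\<lfloor>t / d\<rfloor>\<close> periods moves \<open>t\<close> into a
  compact interval, where the continuous \<open>nu\<close> is bounded.\<close>

lemma bounded_range_nu: "bounded (range nu)"
proof -
  define d where "d = ln (1 / \<beta>)"
  have d: "0 < d" using \<beta> by (simp add: d_def)
  interpret periodic_fun_simple nu d
    by unfold_locales (simp add: d_def nu_periodic)
  have "nu t \<in> nu ` {0..d}" for t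
  proof (rule image_eqI)
    show "nu t = nu (t - of_int \<lfloor>t / d\<rfloor> * d)" by (simp add: minus_of_int)
    have "of_int \<lfloor>t / d\<rfloor> * d \<le> t" "t \<le> (of_int \<lfloor>t / d\<rfloor> + 1) * d"
      using pos_le_divide_eq[OF d, of "of_int \<lfloor>t / d\<rfloor>" t]
        pos_divide_le_eq[OF d, of t "of_int \<lfloor>t / d\<rfloor> + 1"] by linarith+
    then show "t - of_int \<lfloor>t / d\<rfloor> * d \<in> {0..d}"
      by (simp add: distrib_right)
  qed
  then have "range nu \<subseteq> nu ` {0..d}" by blast
  moreover have "compact (nu ` {0..d})"
    using isCont_nu by (intro compact_continuous_image continuous_at_imp_continuous_on) auto
  ultimately show ?thesis using compact_imp_bounded bounded_subset by blast
qed

section \<open>The max-semistable limit\<close>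

lemma H_eq: "H x = (if x < 0 then exp (- ((- x) powr \<alpha> * nu (ln (- x)))) else 1)"
  by (simp add: H_def blowup_eq_powr_nu blowup_nonpos)

text \<open>The witness is \<open>interval_measure H\<close>; its limit 0 at minus infinity comes
  from the divergence of the blow-up.\<close>

lemma distribution_function_H: "distribution_function H"
proof -
  have mono: "H x \<le> H y" if "x \<le> y" for x y
    using blowup_mono[of "- y" "- x"] that by (simp add: H_def)
  have "isCont H x" for x
    unfolding H_def by (intro continuous_intros isCont_o2[OF _ isCont_blowup])
  then have cont: "continuous (at_right x) H" for x
    by (rule continuous_within_subset) simp
  have bot: "(H \<longlongrightarrow> 0) at_bot"
    unfolding H_def
    by (intro filterlim_compose[OF exp_at_bot] filterlim_compose[OF filterlim_uminus_at_bot_at_top]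
        filterlim_compose[OF blowup_at_top] filterlim_uminus_at_top_at_bot)
  have top: "(H \<longlongrightarrow> 1) at_top"
    by (rule tendsto_eventually) (auto simp: H_eq intro!: eventually_at_top_linorderI[of 0])
  show ?thesis
    unfolding distribution_function_def
    using real_distribution_interval_measure[OF mono cont bot top]
      cdf_interval_measure[OF mono cont bot] by metis
qed

lemma nondegenerate_H: "nondegenerate H"
proof -
  have "0 < H (- 1)" "H (- 1) < 1"
    using blowup_pos[of 1] by (simp_all add: H_def)
  then have "H (- 1) \<noteq> (if - 1 < a then 0 else 1)" for a by auto
  then show ?thesis unfolding nondegenerate_def by metis
qed

lemma max_semistable_weibull_H: "max_semistable_weibull \<alpha> (1 / q) H"
proof -
  \<comment> \<open>The period required for the ratio \<open>1 / q\<close> is the period of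
    \<open>nu\<close>, since \<open>1 / \<alpha> = ln \<beta> / ln q\<close>.\<close>
  have "ln ((1 / q) powr (1 / \<alpha>)) = ln (1 / \<beta>)"
    using \<beta> q by (simp add: \<alpha>_def ln_powr ln_div)
  then show ?thesis
    unfolding max_semistable_weibull_def
    using \<alpha>_pos q distribution_function_H nu_pos bounded_range_nu nu_periodic H_eq by auto
qed

end

section \<open>Powers of bases near 1 and floors of geometric sequences\<close>

lemma tendsto_one_minus_power_exp:
  fixes u :: "nat \<Rightarrow> real" and k :: "nat \<Rightarrow> nat"
  assumes u: "u \<longlonglongrightarrow> 0" "\<And>n. 0 < u n" and ku: "(\<lambda>n. real (k n) * u n) \<longlonglongrightarrow> L"
  shows "(\<lambda>n. (1 - u n) ^ k n) \<longlonglongrightarrow> exp (- L)"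
proof -
  \<comment> \<open>The derivative of \<open>ln\<close> at 1 makes
    \<open>- ln (1 - u n) / u n\<close> tend to 1, so \<open>k n * ln (1 - u n)\<close> tends to
    \<open>- L\<close>.\<close>
  have "((\<lambda>h. (ln (1 + h) - ln 1) / h) \<longlongrightarrow> 1) (at (0 :: real))"
    using DERIV_ln[of "1 :: real"] by (simp add: DERIV_def)
  moreover have "filterlim (\<lambda>n. - u n) (at 0) sequentially"
    unfolding filterlim_at using u tendsto_minus[OF u(1)] by (auto simp: less_le)
  ultimately have "(\<lambda>n. (ln (1 + - u n) - ln 1) / - u n) \<longlonglongrightarrow> 1"
    by (rule filterlim_compose)
  from tendsto_mult[OF ku this] have "(\<lambda>n. real (k n) * u n * (- ln (1 - u n) / u n)) \<longlonglongrightarrow> L"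
    by simp
  then have "(\<lambda>n. - (real (k n) * ln (1 - u n))) \<longlonglongrightarrow> L"
    by (rule Lim_transform_eventually) (use u in \<open>auto simp: field_simps less_imp_neq[symmetric]\<close>)
  from tendsto_exp[OF tendsto_minus[OF this]]
  have lim: "(\<lambda>n. exp (real (k n) * ln (1 - u n))) \<longlonglongrightarrow> exp (- L)"
    by simp
  have "\<forall>\<^sub>F n in sequentially. u n < 1"
    using u(1) by (intro order_tendstoD(2)) auto
  then have "\<forall>\<^sub>F n in sequentially. exp (real (k n) * ln (1 - u n)) = (1 - u n) ^ k n"
    by eventually_elim (simp add: exp_of_nat_mult)
  with lim show ?thesis by (rule Lim_transform_eventually)
qed

lemma floor_power_pos: "1 \<le> r \<Longrightarrow> 0 < nat \<lfloor>(r :: real) ^ n\<rfloor>"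
  by (simp add: one_le_power)

lemma floor_power_ratio_tendsto:
  fixes r :: real
  assumes "1 < r"
  shows "(\<lambda>n. real (nat \<lfloor>r ^ n\<rfloor>) / r ^ n) \<longlonglongrightarrow> 1"
proof (rule tendsto_sandwich)
  have "(\<lambda>n. 1 - (1 / r) ^ n) \<longlonglongrightarrow> 1 - 0"
    using assms by (intro tendsto_intros LIMSEQ_power_zero) simp
  then show "(\<lambda>n. 1 - (1 / r) ^ n) \<longlonglongrightarrow> 1" by simp
  have bounds: "r ^ n - 1 \<le> real (nat \<lfloor>r ^ n\<rfloor>)" "real (nat \<lfloor>r ^ n\<rfloor>) \<le> r ^ n" for n
    using assms by (simp_all add: of_nat_nat)
  show "\<forall>\<^sub>F n in sequentially. 1 - (1 / r) ^ n \<le> real (nat \<lfloor>r ^ n\<rfloor>) / r ^ n"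
  proof (rule always_eventually, rule allI)
    fix n
    have "1 - (1 / r) ^ n = (r ^ n - 1) / r ^ n"
      using assms by (simp add: diff_divide_distrib power_divide)
    also have "\<dots> \<le> real (nat \<lfloor>r ^ n\<rfloor>) / r ^ n"
      using bounds[of n] assms by (intro divide_right_mono) auto
    finally show "1 - (1 / r) ^ n \<le> real (nat \<lfloor>r ^ n\<rfloor>) / r ^ n" .
  qed
  show "\<forall>\<^sub>F n in sequentially. real (nat \<lfloor>r ^ n\<rfloor>) / r ^ n \<le> 1"
    using bounds assms by simp
qed (rule tendsto_const)

lemma floor_power_Suc_ratio_tendsto:
  fixes r :: real
  assumes r: "1 < r"
  shows "(\<lambda>n. real (nat \<lfloor>r ^ Suc n\<rfloor>) / real (nat \<lfloor>r ^ n\<rfloor>)) \<longlonglongrightarrow> r"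
proof -
  let ?u = "\<lambda>n. real (nat \<lfloor>r ^ n\<rfloor>) / r ^ n"
  note u = floor_power_ratio_tendsto[OF r]
  have "(\<lambda>n. ?u (Suc n) / ?u n * r) \<longlonglongrightarrow> 1 / 1 * r"
    by (intro tendsto_intros LIMSEQ_Suc u) simp
  moreover have "?u (Suc n) / ?u n * r = real (nat \<lfloor>r ^ Suc n\<rfloor>) / real (nat \<lfloor>r ^ n\<rfloor>)" for n
    using r by (simp add: field_simps)
  ultimately show ?thesis by (simp only: div_by_1 mult_1)
qed

lemma floor_power_eventually_strict_mono:
  fixes r :: real
  assumes r: "1 < r"
  obtains m where "strict_mono (\<lambda>n. nat \<lfloor>r ^ (n + m)\<rfloor>)"
proof -
  \<comment> \<open>From index \<open>m\<close> on, consecutive powers differ by at least 1, so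
    their floors differ.\<close>
  obtain m where m: "1 / (r - 1) < r ^ m"
    using real_arch_pow[OF r] by blast
  have "nat \<lfloor>r ^ (n + m)\<rfloor> < nat \<lfloor>r ^ (Suc n + m)\<rfloor>" for n
  proof -
    have "1 \<le> r ^ m * (r - 1)" using m r by (simp add: field_simps)
    also have "\<dots> \<le> r ^ (n + m) * (r - 1)"
      using r by (intro mult_right_mono power_increasing) auto
    finally have "r ^ (n + m) + 1 \<le> r ^ (Suc n + m)" by (simp add: algebra_simps)
    then have "\<lfloor>r ^ (n + m)\<rfloor> < \<lfloor>r ^ (Suc n + m)\<rfloor>" by linarith
    moreover have "0 \<le> \<lfloor>r ^ (n + m)\<rfloor>" using r by simp
    ultimately show ?thesis by linarith
  qed
  then have "strict_mono (\<lambda>n. nat \<lfloor>r ^ (n + m)\<rfloor>)" by (simp add: strict_mono_Suc_iff)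
  then show ?thesis by (rule that)
qed

text \<open>The subtracted term is eventually \<open>q ^ n * blowup (- x)\<close>, so its product
  with the floor tends to \<open>blowup (- x)\<close>.\<close>

lemma (in selfsimilar_at_zero) one_minus_power_tendsto_H:
  assumes "x < 0"
  shows "(\<lambda>n. (1 - G (\<beta> ^ n * - x)) ^ nat \<lfloor>(1 / q) ^ n\<rfloor>) \<longlonglongrightarrow> H x"
  unfolding H_def
proof (rule tendsto_one_minus_power_exp)
  have "(\<lambda>n. \<beta> ^ n * - x) \<longlonglongrightarrow> 0 * - x"
    using \<beta> by (intro tendsto_intros LIMSEQ_power_zero) simp
  then have "(\<lambda>n. G (\<beta> ^ n * - x)) \<longlonglongrightarrow> G 0"
    using isCont_tendsto_compose[OF G_cont] by simp
  then show "(\<lambda>n. G (\<beta> ^ n * - x)) \<longlonglongrightarrow> 0"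
    by (simp add: G_nonpos)
  show "0 < G (\<beta> ^ n * - x)" for n
    using assms \<beta> by (intro G_pos mult_pos_pos) auto
  have "(\<lambda>n. real (nat \<lfloor>(1 / q) ^ n\<rfloor>) / (1 / q) ^ n * blowup (- x)) \<longlonglongrightarrow> 1 * blowup (- x)"
    using q by (intro tendsto_intros floor_power_ratio_tendsto) simp
  moreover have "\<forall>\<^sub>F n in sequentially. real (nat \<lfloor>(1 / q) ^ n\<rfloor>) / (1 / q) ^ n * blowup (- x) =
      real (nat \<lfloor>(1 / q) ^ n\<rfloor>) * G (\<beta> ^ n * - x)"
    using eventually_power_le[of "- x"]
  proof eventually_elim
    case (elim n)
    then show ?case using blowup_eq[OF elim] q by (simp add: power_divide)
  qed
  ultimately show "(\<lambda>n. real (nat \<lfloor>(1 / q) ^ n\<rfloor>) * G (\<beta> ^ n * - x)) \<longlonglongrightarrow> blowup (- x)"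
    using Lim_transform_eventually by fastforce
qed

section \<open>The stationary distribution function and its maxima\<close>

lemma isCont_ar1_cdf:
  assumes "0 < \<beta>" "\<beta> < 1" "0 < p" "p < 1"
  shows "isCont (ar1_cdf \<beta> p) y"
proof -
  interpret L: real_distribution "ar1_law \<beta> p" by (rule real_distribution_ar1)
  show ?thesis unfolding ar1_cdf_def using L.isCont_cdf ar1_law_no_atoms[OF assms] by simp
qed

lemma ar1_cdf_mono: "x \<le> y \<Longrightarrow> ar1_cdf \<beta> p x \<le> ar1_cdf \<beta> p y"
proof -
  interpret L: real_distribution "ar1_law \<beta> p" by (rule real_distribution_ar1)
  show "x \<le> y \<Longrightarrow> ar1_cdf \<beta> p x \<le> ar1_cdf \<beta> p y"
    unfolding ar1_cdf_def by (rule L.cdf_nondecreasing)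
qed

lemma ar1_cdf_eq_measure:
  "ar1_cdf \<beta> p y = measure (ar1_space p) {\<omega> \<in> space (ar1_space p). ar1_stationary \<beta> \<omega> \<le> y}"
  unfolding ar1_cdf_def cdf_def
  by (subst measure_distr) (auto intro!: arg_cong2[where f=measure])

lemma ar1_cdf_ge_1:
  assumes "0 < \<beta>" "\<beta> < 1" "1 \<le> y"
  shows "ar1_cdf \<beta> p y = 1"
proof -
  interpret prob_space "ar1_space p" by (rule prob_space_ar1_space)
  have "{\<omega> \<in> space (ar1_space p). ar1_stationary \<beta> \<omega> \<le> y} = space (ar1_space p)"
    using ar1_stationary_bounds(2)[OF assms(1,2)] assms(3) by (auto intro: order_trans)
  then show ?thesis by (simp only: ar1_cdf_eq_measure prob_space)
qed

text \<open>There is no mass below 0 and no atom at 0.\<close>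

lemma ar1_cdf_nonpos:
  assumes "0 < \<beta>" "\<beta> < 1" "0 < p" "p < 1" "y \<le> 0"
  shows "ar1_cdf \<beta> p y = 0"
proof -
  interpret L: real_distribution "ar1_law \<beta> p" by (rule real_distribution_ar1)
  have "ar1_stationary \<beta> -` {..<0} \<inter> space (ar1_space p) = {}"
    using ar1_stationary_bounds(1)[OF assms(1,2)] by (auto simp flip: not_le)
  then have neg: "L.prob {..<0} = 0"
    by (simp add: measure_distr)
  have "ar1_cdf \<beta> p y \<le> ar1_cdf \<beta> p 0"
    using assms(5) by (rule ar1_cdf_mono)
  also have "\<dots> = L.prob ({..<0} \<union> {0})"
    unfolding ar1_cdf_def cdf_def by (simp only: ivl_disj_un_singleton)
  also have "\<dots> = 0"
    by (subst L.finite_measure_Union) (simp_all add: neg ar1_law_no_atoms[OF assms(1-4)])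
  finally show ?thesis
    using L.cdf_nonneg by (simp add: ar1_cdf_def antisym)
qed

lemma ar1_cdf_selfsimilar:
  assumes \<beta>: "0 < \<beta>" "\<beta> < 1" and p: "0 \<le> p" "p \<le> 1"
  shows "ar1_cdf \<beta> p (\<beta> * y) = p * ar1_cdf \<beta> p y + (1 - p) * ar1_cdf \<beta> p (y - (1 / \<beta> - 1))"
proof -
  have "{s. \<beta> * s \<in> {..\<beta> * y}} = {..y}" "{s. 1 - \<beta> + \<beta> * s \<in> {..\<beta> * y}} = {..y - (1 / \<beta> - 1)}"
    using \<beta> by (auto simp: field_simps)
  then show ?thesis
    unfolding ar1_cdf_def cdf_def using ar1_law_selfsimilar[OF \<beta> p, of "{..\<beta> * y}"] by simp
qed

text \<open>Starting from the value 1 at 1 and dropping the second branch of the self-similarity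
  gives the lower bound \<open>p ^ n\<close> at \<open>\<beta> ^ n\<close>; these points tend to
  0.\<close>

lemma ar1_cdf_pos:
  assumes \<beta>: "0 < \<beta>" "\<beta> < 1" and p: "0 < p" "p < 1" and y: "0 < y"
  shows "0 < ar1_cdf \<beta> p y"
proof -
  have lower: "p ^ n \<le> ar1_cdf \<beta> p (\<beta> ^ n)" for n
  proof (induction n)
    case 0
    show ?case using ar1_cdf_ge_1[OF \<beta>, of 1] by simp
  next
    case (Suc n)
    have "p ^ Suc n \<le> p * ar1_cdf \<beta> p (\<beta> ^ n)" using Suc p by simp
    also have "\<dots> \<le> ar1_cdf \<beta> p (\<beta> ^ Suc n)"
      using ar1_cdf_selfsimilar[OF \<beta>, of p "\<beta> ^ n"] p by (simp add: ar1_cdf_def cdf_def)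
    finally show ?case .
  qed
  obtain n where "\<beta> ^ n < y" using real_arch_pow_inv[OF y \<beta>(2)] by blast
  then have "p ^ n \<le> ar1_cdf \<beta> p y"
    using lower[of n] ar1_cdf_mono[of "\<beta> ^ n" y \<beta> p] by linarith
  then show ?thesis using p zero_less_power[of p n] by linarith
qed

text \<open>Reflection turns \<open>{..y}\<close> into \<open>{1 - y..}\<close>; the absence of
  atoms lets the endpoint be dropped before taking the complement.\<close>

lemma ar1_cdf_reflect:
  assumes \<beta>: "0 < \<beta>" "\<beta> < 1" and p: "0 < p" "p < 1"
  shows "ar1_cdf \<beta> p (1 - y) = 1 - ar1_cdf \<beta> (1 - p) y"
proof -
  interpret L: real_distribution "ar1_law \<beta> p" by (rule real_distribution_ar1)
  have "(\<lambda>s. 1 - s) -` {..y} = {1 - y..}" by auto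
  then have "ar1_cdf \<beta> (1 - p) y = L.prob {1 - y..}"
    unfolding ar1_cdf_def cdf_def using ar1_law_reflect[OF \<beta>, of p] p
    by (simp add: measure_distr)
  also have "\<dots> = L.prob ({1 - y} \<union> {1 - y<..})"
    by (simp only: ivl_disj_un_singleton)
  also have "\<dots> = L.prob {1 - y<..}"
    by (subst L.finite_measure_Union) (simp_all add: ar1_law_no_atoms[OF assms])
  also have "{1 - y<..} = space (ar1_law \<beta> p) - {..1 - y}" by auto
  also have "L.prob \<dots> = 1 - L.prob {..1 - y}"
    by (rule L.prob_compl) simp
  finally show ?thesis by (simp add: ar1_cdf_def cdf_def)
qed

lemma selfsimilar_at_zero_ar1_cdf:
  assumes \<beta>: "0 < \<beta>" "\<beta> < 1" and q: "0 < q" "q < 1"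
  shows "selfsimilar_at_zero (ar1_cdf \<beta> q) \<beta> q (1 / \<beta> - 1)"
proof unfold_locales
  \<comment> \<open>In this range the second branch is evaluated at a nonpositive point and
    vanishes.\<close>
  show "ar1_cdf \<beta> q (\<beta> * y) = q * ar1_cdf \<beta> q y" if "y \<le> 1 / \<beta> - 1" for y
    using ar1_cdf_selfsimilar[OF \<beta>, of q y] ar1_cdf_nonpos[OF assms, of "y - (1 / \<beta> - 1)"] that q
    by simp
qed (use assms in \<open>auto intro: isCont_ar1_cdf ar1_cdf_mono ar1_cdf_nonpos ar1_cdf_pos\<close>)

lemma (in selfsimilar_at_zero) is_nu_ext_nu:
  assumes "G = ar1_cdf \<beta> q" and "c = 1 / \<beta> - 1"
  shows "is_nu_ext \<beta> q nu"
proof -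
  have "continuous_on {..ln (1 / \<beta> - 1)} nu"
    using isCont_nu by (simp add: continuous_at_imp_continuous_on)
  moreover have "nu (t - ln (1 / \<beta>)) = nu t" for t
    using nu_periodic[of "t - ln (1 / \<beta>)"] by simp
  \<comment> \<open>Index 0 suffices on this interval, so the blow-up is the distribution function
    itself.\<close>
  moreover have "ar1_cdf \<beta> q y = y powr (ln q / ln \<beta>) * nu (ln y)" if "y \<in> {0<..1 / \<beta> - 1}" for y
    using that blowup_eq[of 0 y] blowup_eq_powr_nu[of y] by (simp add: assms \<alpha>_def)
  ultimately show ?thesis
    unfolding is_nu_ext_def is_nu_def using nu_pos nu_periodic by blast
qed

section \<open>Maxima of independent variables and the limit theorem\<close>

lemma (in prob_space) prob_Max_le:
  fixes Y :: "nat \<Rightarrow> 'a \<Rightarrow> real"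
  assumes indep: "indep_vars (\<lambda>_. borel) Y UNIV"
    and F: "\<And>i. cdf (distr M borel (Y i)) = F" and k: "0 < k"
  shows "prob {\<omega> \<in> space M. Max ((\<lambda>i. Y i \<omega>) ` {..<k}) \<le> z} = F z ^ k"
proof -
  have [measurable]: "Y i \<in> borel_measurable M" for i
    using indep by (simp add: indep_vars_def)
  have "{\<omega> \<in> space M. Max ((\<lambda>i. Y i \<omega>) ` {..<k}) \<le> z} = (\<Inter>i\<in>{..<k}. Y i -` {..z} \<inter> space M)"
    using k by (subst Max_le_iff) auto
  also have "prob \<dots> = (\<Prod>i<k. prob (Y i -` {..z} \<inter> space M))"
    using k by (intro indep_varsD[OF indep]) auto
  also have "\<dots> = (\<Prod>i<k. F z)"
  proof (intro prod.cong refl)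
    fix i
    show "prob (Y i -` {..z} \<inter> space M) = F z"
      using fun_cong[OF F[of i], of z] by (simp add: cdf_def measure_distr)
  qed
  finally show ?thesis by simp
qed

theorem theorem2p3:
  fixes \<beta> p q :: real
    and M :: "'a measure" and Y :: "nat \<Rightarrow> 'a \<Rightarrow> real"
    and a b :: "nat \<Rightarrow> real" and k :: "nat \<Rightarrow> nat"
  assumes "1/2 < \<beta>" and "\<beta> < 1"
    and "0 < p" and "p < 1" and "q = 1 - p"
    and "prob_space M"
    and "prob_space.indep_vars M (\<lambda>_. borel) Y UNIV"
    and "\<And>i. cdf (distr M borel (Y i)) = ar1_cdf \<beta> p"
    and "\<And>n. a n = (1 / \<beta>) ^ n"
    and "\<And>n. b n = 1"
    and "\<And>n. k n = nat \<lfloor>(1 / q) ^ n\<rfloor>"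
  shows "(\<forall>x<0. (\<lambda>n. measure M {\<omega> \<in> space M.
              a n * (Max ((\<lambda>i. Y i \<omega>) ` {..<k n}) - b n) \<le> x})
            \<longlonglongrightarrow> exp (- ((- x) powr (ln q / ln \<beta>) * nu_ext \<beta> q (ln (- x)))))
       \<and> ln q / ln \<beta> > 0 \<and> 1 / q > 1
       \<and> (\<exists>H. max_semistable_weibull (ln q / ln \<beta>) (1 / q) H
             \<and> in_geometric_partial_attraction (1 / q) (ar1_cdf \<beta> p) H)"
proof -
  have \<beta>: "0 < \<beta>" "\<beta> < 1" and p: "0 < p" "p < 1" and q: "0 < q" "q < 1" "1 - p = q"
    using assms(1-5) by auto
  interpret M: prob_space M by fact
  interpret L: selfsimilar_at_zero "ar1_cdf \<beta> q" \<beta> q "1 / \<beta> - 1"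
    using \<beta> q by (intro selfsimilar_at_zero_ar1_cdf) auto
  have r: "1 < 1 / q" using q by simp
  \<comment> \<open>The periodic extension is unique, so the definite description picks
    \<open>L.nu\<close>.\<close>
  have nu: "nu_ext \<beta> q = L.nu"
    using \<beta> L.is_nu_ext_nu by (intro nu_ext_eqI) auto
  have k_pos: "0 < k n" for n
    using r floor_power_pos[of "1 / q" n] assms(11)[of n] by linarith
  have F: "ar1_cdf \<beta> p (\<beta> ^ n * x + 1) = 1 - ar1_cdf \<beta> q (\<beta> ^ n * - x)" for n x
    using ar1_cdf_reflect[OF \<beta> p, of "\<beta> ^ n * - x"] q by (simp add: add.commute)
  have lim: "(\<lambda>n. ar1_cdf \<beta> p (\<beta> ^ n * x + 1) ^ k n) \<longlonglongrightarrow> L.H x" for x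
  proof (cases "x < 0")
    case True
    then show ?thesis using L.one_minus_power_tendsto_H by (simp only: F assms(11))
  next
    case False
    \<comment> \<open>For \<open>x \<ge> 0\<close> the threshold is at least 1, where the
      distribution function is 1.\<close>
    then have "1 \<le> \<beta> ^ n * x + 1" for n using \<beta> by simp
    then show ?thesis using False \<beta> by (simp add: ar1_cdf_ge_1 L.H_eq)
  qed
  have "(\<lambda>n. measure M {\<omega> \<in> space M. a n * (Max ((\<lambda>i. Y i \<omega>) ` {..<k n}) - b n) \<le> x})
      \<longlonglongrightarrow> exp (- ((- x) powr (ln q / ln \<beta>) * nu_ext \<beta> q (ln (- x))))" if "x < 0" for x
  proof -
    have "a n * (m - b n) \<le> x \<longleftrightarrow> m \<le> \<beta> ^ n * x + 1" for n m
      using \<beta> by (simp add: assms(9,10) power_one_over field_simps)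
    then have "measure M {\<omega> \<in> space M. a n * (Max ((\<lambda>i. Y i \<omega>) ` {..<k n}) - b n) \<le> x} =
        ar1_cdf \<beta> p (\<beta> ^ n * x + 1) ^ k n" for n
      using M.prob_Max_le[OF assms(7,8) k_pos] by simp
    then show ?thesis
      using lim[of x] that by (simp add: L.H_eq nu L.\<alpha>_def)
  qed
  moreover have "in_geometric_partial_attraction (1 / q) (ar1_cdf \<beta> p) L.H"
  proof -
    \<comment> \<open>If \<open>q\<close> is close to \<open>1\<close>, then \<open>k\<close> is constant at first, hence the shift.\<close>
    obtain m where m: "strict_mono (\<lambda>n. k (n + m))"
      using floor_power_eventually_strict_mono[OF r] unfolding assms(11) by blast
    have "(\<lambda>n. real (k (Suc n + m)) / real (k (n + m))) \<longlonglongrightarrow> 1 / q"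
      using LIMSEQ_ignore_initial_segment[OF floor_power_Suc_ratio_tendsto[OF r], of m]
      by (simp add: assms(11))
    \<comment> \<open>The definition of the domain of attraction inverts the scale \<open>a\<close>,
      hence the double inverse.\<close>
    moreover have "(\<lambda>n. ar1_cdf \<beta> p (inverse (inverse (\<beta> ^ (n + m))) * x + 1) ^ k (n + m)) \<longlonglongrightarrow> L.H x" for x
      using LIMSEQ_ignore_initial_segment[OF lim[of x], of m] by simp
    moreover have "distribution_function (ar1_cdf \<beta> p)"
      unfolding distribution_function_def ar1_cdf_def using real_distribution_ar1 by blast
    ultimately show ?thesis
      unfolding in_geometric_partial_attraction_def
      using L.distribution_function_H L.nondegenerate_H r m k_pos \<beta>
      by (intro conjI exI[of _ "\<lambda>n. k (n + m)"] exI[of _ "\<lambda>n. inverse (\<beta> ^ (n + m))"] exI[of _ "\<lambda>_. 1"]) auto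
  qed
  ultimately show ?thesis
    using L.max_semistable_weibull_H L.\<alpha>_pos r unfolding L.\<alpha>_def by blast
qed

end
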